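(* Let $A$ be a finite set of atoms. The set of all Krom theories over $A$ is a subnear-semiring of $(\mathcal H_A,\cup,\circ,\emptyset)$ (i.e. it contains $\emptyset$ and is closed under $\cup$ and $\circ$). Moreover, Krom theories distribute from the left: for every Krom theory $K$ and all propositional Horn theories $P,R$ over $A$, $$K\circ(P\cup R)=(K\circ P)\cup(K\circ R).$$ Consequently, the set of proper Krom theories over $A$ forms a finite idempotent semiring with respect to $\cup$ and $\circ$ (with zero $\emptyset$).
   Context: A theory over a finite alphabet $A$ is a finite set of rules $a_0\leftarrow a_1,\ldots,a_k$ ($k\ge0$, $a_i\in A$), with $head(r)=\{a_0\}$, $body(r)=\{a_1,\ldots,a_k\}$, size of $r$ equal to $k$; $head(S),body(S)$ are unions over a set $S$ of rules. $\mathcal H_A$ denotes the set of all theories over $A$. A fact is a rule with empty body; a proper rule is a rule that is not a fact. A rule is Krom if it has at most one body atom; a theory is Krom if all its rules are Krom; a proper Krom theory is a Krom theory all of whose rules have exactly one body atom. Write $S\subseteq_r R$ if $S\subseteq R$ has as many elements as the size of $r$. Composition: $P\circ R=\{head(r)\leftarrow body(S)\mid r\in P,\ S\subseteq_r R,\ head(S)=body(r)\}$. A near-semiring is $(S,+,\cdot,0)$ with $(S,+,0)$ a monoid, $(S,\cdot)$ a semigroup, $(x+y)z=xz+yz$ and $0x=0$; idempotent means $x+x=x$. A semiring is a near-semiring in which $+$ is commutative and additionally $x(y+z)=xy+xz$ and $x0=0$ for all $x,y,z$. *)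

theory Defs
  imports Main
begin

(* Bodies are sets of atoms, as forced by composition, which builds rules with body "bodies S". *)
datatype 'a rule = Rule (head_atom: 'a) (body: "'a set")

definition head :: "'a rule \<Rightarrow> 'a set" where
  "head r = {head_atom r}"

definition rule_size :: "'a rule \<Rightarrow> nat" where
  "rule_size r = card (body r)"

definition heads :: "'a rule set \<Rightarrow> 'a set" where
  "heads S = (\<Union>r\<in>S. head r)"

definition bodies :: "'a rule set \<Rightarrow> 'a set" where
  "bodies S = (\<Union>r\<in>S. body r)"

definition rules_over :: "'a set \<Rightarrow> 'a rule set" where
  "rules_over A = {r. head_atom r \<in> A \<and> finite (body r) \<and> body r \<subseteq> A}"

definition horn_theories :: "'a set \<Rightarrow> 'a rule set set" where
  "horn_theories A = {P. finite P \<and> P \<subseteq> rules_over A}"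

definition krom_theories :: "'a set \<Rightarrow> 'a rule set set" where
  "krom_theories A = {P \<in> horn_theories A. \<forall>r\<in>P. rule_size r \<le> 1}"

definition proper_krom_theories :: "'a set \<Rightarrow> 'a rule set set" where
  "proper_krom_theories A = {P \<in> krom_theories A. \<forall>r\<in>P. rule_size r = 1}"

(* "finite S" is automatic for finite R; it excludes infinite sets, whose "card" is 0. *)
definition subset_for :: "'a rule \<Rightarrow> 'a rule set \<Rightarrow> 'a rule set \<Rightarrow> bool" where
  "subset_for r S R \<longleftrightarrow> S \<subseteq> R \<and> finite S \<and> card S = rule_size r"

definition compose :: "'a rule set \<Rightarrow> 'a rule set \<Rightarrow> 'a rule set"  (infixl "\<odot>" 70) where
  "P \<odot> R = {Rule (head_atom r) (bodies S) | r S. r \<in> P \<and> subset_for r S R \<and> heads S = body r}"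

(* The multiplication is not required to have a unit, hence these are not the
   semirings of HOL-Algebra. *)
locale near_semiring_on =
  fixes S :: "'s set"
    and add :: "'s \<Rightarrow> 's \<Rightarrow> 's"  (infixl "\<oplus>" 65)
    and mult :: "'s \<Rightarrow> 's \<Rightarrow> 's"  (infixl "\<otimes>" 70)
    and zero :: 's  ("\<zero>")
  assumes zero_closed: "\<zero> \<in> S"
    and add_closed: "x \<in> S \<Longrightarrow> y \<in> S \<Longrightarrow> x \<oplus> y \<in> S"
    and mult_closed: "x \<in> S \<Longrightarrow> y \<in> S \<Longrightarrow> x \<otimes> y \<in> S"
    and add_assoc: "x \<in> S \<Longrightarrow> y \<in> S \<Longrightarrow> z \<in> S \<Longrightarrow> (x \<oplus> y) \<oplus> z = x \<oplus> (y \<oplus> z)"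
    and add_zero_left: "x \<in> S \<Longrightarrow> \<zero> \<oplus> x = x"
    and add_zero_right: "x \<in> S \<Longrightarrow> x \<oplus> \<zero> = x"
    and mult_assoc: "x \<in> S \<Longrightarrow> y \<in> S \<Longrightarrow> z \<in> S \<Longrightarrow> (x \<otimes> y) \<otimes> z = x \<otimes> (y \<otimes> z)"
    and distrib_right: "x \<in> S \<Longrightarrow> y \<in> S \<Longrightarrow> z \<in> S \<Longrightarrow> (x \<oplus> y) \<otimes> z = x \<otimes> z \<oplus> y \<otimes> z"
    and mult_zero_left: "x \<in> S \<Longrightarrow> \<zero> \<otimes> x = \<zero>"

locale semiring_on = near_semiring_on +
  assumes add_commute: "x \<in> S \<Longrightarrow> y \<in> S \<Longrightarrow> x \<oplus> y = y \<oplus> x"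
    and distrib_left: "x \<in> S \<Longrightarrow> y \<in> S \<Longrightarrow> z \<in> S \<Longrightarrow> x \<otimes> (y \<oplus> z) = x \<otimes> y \<oplus> x \<otimes> z"
    and mult_zero_right: "x \<in> S \<Longrightarrow> x \<otimes> \<zero> = \<zero>"

locale idempotent_semiring_on = semiring_on +
  assumes add_idem: "x \<in> S \<Longrightarrow> x \<oplus> x = x"

(* A subset T of the carrier S that contains zero, is closed under both operations and satisfies
   the near-semiring laws. The laws are not demanded of S itself: composition of arbitrary Horn
   theories is not associative. For P = {a <- b,c}, Q = {b <- d, c <- d}, R = {d <- e, d <- f},
   the theory P \<odot> (Q \<odot> R) contains a <- e,f, whereas (P \<odot> Q) \<odot> R does not. *)
definition sub_near_semiring ::
    "'s set \<Rightarrow> 's set \<Rightarrow> ('s \<Rightarrow> 's \<Rightarrow> 's) \<Rightarrow> ('s \<Rightarrow> 's \<Rightarrow> 's) \<Rightarrow> 's \<Rightarrow> bool" where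
  "sub_near_semiring T S add mult zero \<longleftrightarrow> T \<subseteq> S \<and> near_semiring_on T add mult zero"

end

theory Submission
  imports Defs
begin

text \<open>A Krom rule selects at most one rule of the right factor, so \<open>K \<odot> R\<close> consists of the facts
  of \<open>K\<close> and the chains \<open>a \<leftarrow> b\<close> in \<open>K\<close>, \<open>b \<leftarrow> B\<close> in \<open>R\<close>: it is a relational composition in which
  facts of the left factor survive. All the laws can be read off from this description.\<close>

lemma krom_body_cases:
  assumes "K \<in> krom_theories A" "r \<in> K"
  obtains "body r = {}" | b where "body r = {b}"
proof -
  \<comment> \<open>Finiteness matters because \<open>card\<close> is 0 on infinite sets, so the
    bound alone would not force the body to be empty or a singleton.\<close>
  have "finite (body r)" "card (body r) \<le> 1"
    using assms by (auto simp: krom_theories_def horn_theories_def rules_over_def rule_size_def)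
  then show thesis
    using that by (metis card_0_eq card_1_singletonE le_eq_less_or_eq less_one)
qed

text \<open>A body of size 0 selects a finite set of cardinality 0. Hence a fact survives
  composition with every \<open>R\<close>, even with \<open>{}\<close>.\<close>

lemma subset_for_fact:
  "body r = {} \<Longrightarrow> subset_for r S R \<and> heads S = body r \<longleftrightarrow> S = {}"
  by (auto simp: subset_for_def rule_size_def heads_def head_def)

lemma subset_for_singleton:
  "body r = {b} \<Longrightarrow> subset_for r S R \<and> heads S = body r \<longleftrightarrow> (\<exists>s\<in>R. S = {s} \<and> head_atom s = b)"
  by (auto simp: subset_for_def rule_size_def heads_def head_def card_1_singleton_iff)

lemma compose_memI:
  assumes "r \<in> P" "subset_for r S R \<and> heads S = body r"
  shows "Rule (head_atom r) (bodies S) \<in> P \<odot> R"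
  using assms unfolding compose_def by blast

text \<open>The quantifier over subsets \<open>S\<close> of \<open>R\<close> becomes one over a
  single linking atom \<open>b\<close>. Membership in \<open>R\<close> then occurs just once and
  positively, so the laws below reduce to first-order reasoning about rules.\<close>

lemma mem_compose_krom_iff:
  assumes "K \<in> krom_theories A"
  shows "Rule a B \<in> K \<odot> R \<longleftrightarrow>
    Rule a B \<in> K \<and> B = {} \<or> (\<exists>b. Rule a {b} \<in> K \<and> Rule b B \<in> R)" (is "_ \<longleftrightarrow> ?chain")
proof
  assume "Rule a B \<in> K \<odot> R"
  then obtain r S where r: "r \<in> K" "head_atom r = a" "B = bodies S"
    and S: "subset_for r S R \<and> heads S = body r"
    unfolding compose_def by auto
  from assms r(1) show ?chain
  proof (cases rule: krom_body_cases)
    case 1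
    have "S = {}"
      using S unfolding subset_for_fact[OF 1] .
    then have "B = {}"
      using r(3) by (simp add: bodies_def)
    moreover have "r = Rule a {}"
      using r(2) 1 by (metis rule.collapse)
    ultimately show ?thesis
      using r(1) by simp
  next
    case (2 b)
    obtain s where s: "s \<in> R" "S = {s}" "head_atom s = b"
      using S unfolding subset_for_singleton[OF 2] by blast
    have "s = Rule b B"
      using r(3) s by (cases s) (simp add: bodies_def)
    moreover have "r = Rule a {b}"
      using r(2) 2 by (metis rule.collapse)
    ultimately show ?thesis
      using r(1) s(1) by blast
  qed
next
  assume ?chain
  then show "Rule a B \<in> K \<odot> R"
  proof (elim disjE conjE exE)
    assume "Rule a B \<in> K" "B = {}"
    then show ?thesis
      using compose_memI[of "Rule a {}" K "{}" R] subset_for_fact[of "Rule a {}" "{}" R]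
      by (simp add: bodies_def)
  next
    fix b
    assume "Rule a {b} \<in> K" "Rule b B \<in> R"
    then show ?thesis
      using compose_memI[of "Rule a {b}" K "{Rule b B}" R]
        subset_for_singleton[of "Rule a {b}" b "{Rule b B}" R]
      by (simp add: bodies_def)
  qed
qed

lemma rule_set_eqI: "(\<And>a B. Rule a B \<in> P \<longleftrightarrow> Rule a B \<in> R) \<Longrightarrow> P = R"
  by (metis rule.exhaust subsetI subset_antisym)

lemma compose_Un_left: "(P \<union> Q) \<odot> R = P \<odot> R \<union> Q \<odot> R"
  by (auto simp: compose_def)

lemma compose_empty_left: "{} \<odot> R = {}"
  by (simp add: compose_def)

text \<open>The existential over \<open>b\<close> commutes with the disjunction coming from the
  union, and the facts of \<open>K\<close> belong to both summands on the right.\<close>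

lemma krom_compose_Un_right:
  "K \<in> krom_theories A \<Longrightarrow> K \<odot> (P \<union> R) = K \<odot> P \<union> K \<odot> R"
  by (rule rule_set_eqI) (auto simp: mem_compose_krom_iff)

lemma finite_rules_over: "finite A \<Longrightarrow> finite (rules_over A)"
proof (rule finite_subset)
  show "rules_over A \<subseteq> (\<lambda>(a, B). Rule a B) ` (A \<times> Pow A)"
    by (auto simp: rules_over_def image_iff) (metis PowI rule.collapse)
qed simp

text \<open>Over a finite alphabet all finiteness conditions are automatic, which leaves a condition
  on each rule separately.\<close>

lemma mem_krom_theories_iff:
  assumes "finite A"
  shows "P \<in> krom_theories A \<longleftrightarrow>
    (\<forall>a B. Rule a B \<in> P \<longrightarrow> a \<in> A \<and> B \<subseteq> A \<and> card B \<le> 1)"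
proof -
  have "finite P" if "P \<subseteq> rules_over A"
    using that finite_rules_over[OF assms] by (rule finite_subset)
  then have "P \<in> krom_theories A \<longleftrightarrow> P \<subseteq> rules_over A \<and> (\<forall>r\<in>P. rule_size r \<le> 1)"
    by (auto simp: krom_theories_def horn_theories_def)
  also have "\<dots> \<longleftrightarrow> (\<forall>r\<in>P. head_atom r \<in> A \<and> body r \<subseteq> A \<and> card (body r) \<le> 1)"
    using assms by (auto simp: rules_over_def rule_size_def intro: finite_subset)
  also have "\<dots> \<longleftrightarrow> (\<forall>a B. Rule a B \<in> P \<longrightarrow> a \<in> A \<and> B \<subseteq> A \<and> card B \<le> 1)"
    by (metis rule.collapse rule.sel)
  finally show ?thesis .
qed

text \<open>A chain takes its head from \<open>K\<close> and its body from \<open>L\<close>, so it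
  inherits the bounds from both.\<close>

lemma krom_compose_closed:
  assumes "finite A" "K \<in> krom_theories A" "L \<in> krom_theories A"
  shows "K \<odot> L \<in> krom_theories A"
  unfolding mem_krom_theories_iff[OF assms(1)] mem_compose_krom_iff[OF assms(2)]
  using assms(2,3)[unfolded mem_krom_theories_iff[OF assms(1)]] by blast

text \<open>Both sides consist of the facts of \<open>K\<close>, the chains from a rule of
  \<open>K\<close> to a fact of \<open>L\<close>, and the chains of three rules through
  \<open>K\<close>, \<open>L\<close> and \<open>R\<close>. Closure makes the chain description
  available for the left factor \<open>K \<odot> L\<close>.\<close>

lemma krom_compose_assoc:
  assumes "finite A" "K \<in> krom_theories A" "L \<in> krom_theories A"
  shows "(K \<odot> L) \<odot> R = K \<odot> (L \<odot> R)"
  by (rule rule_set_eqI)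
    (auto simp: mem_compose_krom_iff[OF krom_compose_closed[OF assms]]
      mem_compose_krom_iff[OF assms(2)] mem_compose_krom_iff[OF assms(3)])

lemma near_semiring_on_krom_theories:
  assumes "finite A"
  shows "near_semiring_on (krom_theories A) (\<union>) (\<odot>) {}"
proof
  show "{} \<in> krom_theories A"
    by (simp add: mem_krom_theories_iff[OF assms])
  show "K \<union> L \<in> krom_theories A" if "K \<in> krom_theories A" "L \<in> krom_theories A" for K L
    using that by (auto simp: mem_krom_theories_iff[OF assms])
qed (auto simp: krom_compose_closed[OF assms] krom_compose_assoc[OF assms]
    compose_Un_left compose_empty_left)

lemma mem_proper_krom_theories_iff:
  "P \<in> proper_krom_theories A \<longleftrightarrow>
    P \<in> krom_theories A \<and> (\<forall>a B. Rule a B \<in> P \<longrightarrow> card B = 1)"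
proof -
  have "(\<forall>r\<in>P. card (body r) = 1) \<longleftrightarrow> (\<forall>a B. Rule a B \<in> P \<longrightarrow> card B = 1)"
    by (metis rule.collapse rule.sel(2))
  then show ?thesis
    by (simp add: proper_krom_theories_def rule_size_def)
qed

text \<open>For Krom \<open>K\<close>, the theory \<open>K \<odot> {}\<close> is the set of facts of
  \<open>K\<close>, and a proper theory has none.\<close>

lemma proper_krom_compose_empty_right:
  "K \<in> proper_krom_theories A \<Longrightarrow> K \<odot> {} = {}"
  by (rule rule_set_eqI) (fastforce simp: mem_proper_krom_theories_iff mem_compose_krom_iff)

lemma proper_krom_compose_closed:
  assumes "finite A" "K \<in> proper_krom_theories A" "L \<in> proper_krom_theories A"
  shows "K \<odot> L \<in> proper_krom_theories A"
proof -
  have K: "K \<in> krom_theories A" and L: "L \<in> krom_theories A"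
    and proper: "Rule a B \<in> K \<union> L \<Longrightarrow> card B = 1" for a B
    using assms(2,3) by (auto simp: mem_proper_krom_theories_iff)
  have "card B = 1" if "Rule a B \<in> K \<odot> L" for a B
    \<comment> \<open>In either case of the chain description, \<open>B\<close> is the body of a
      rule of \<open>K\<close> or of \<open>L\<close>.\<close>
    using that proper unfolding mem_compose_krom_iff[OF K] by blast
  then show ?thesis
    using krom_compose_closed[OF assms(1) K L] by (simp add: mem_proper_krom_theories_iff)
qed

lemma idempotent_semiring_on_proper_krom_theories:
  assumes "finite A"
  shows "idempotent_semiring_on (proper_krom_theories A) (\<union>) (\<odot>) {}"
proof -
  \<comment> \<open>Associativity of \<open>\<odot>\<close> is inherited from the larger carrier of
    all Krom theories.\<close>
  interpret krom: near_semiring_on "krom_theories A" "(\<union>)" "(\<odot>)" "{}"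
    by (rule near_semiring_on_krom_theories[OF assms])
  have krom: "K \<in> krom_theories A" if "K \<in> proper_krom_theories A" for K
    using that by (simp add: proper_krom_theories_def)
  show ?thesis
  proof
    show "{} \<in> proper_krom_theories A"
      by (simp add: proper_krom_theories_def krom.zero_closed)
    show "K \<union> L \<in> proper_krom_theories A"
      if "K \<in> proper_krom_theories A" "L \<in> proper_krom_theories A" for K L
      using that by (auto simp: proper_krom_theories_def krom.add_closed)
  qed (simp_all add: proper_krom_compose_closed[OF assms] krom krom.mult_assoc compose_Un_left
      compose_empty_left krom_compose_Un_right[OF krom] proper_krom_compose_empty_right
      Un_ac)
qed

lemma finite_proper_krom_theories:
  assumes "finite A"
  shows "finite (proper_krom_theories A)"
proof (rule finite_subset)
  show "proper_krom_theories A \<subseteq> Pow (rules_over A)"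
    by (auto simp: proper_krom_theories_def krom_theories_def horn_theories_def)
qed (simp add: finite_rules_over[OF assms])

theorem theorem3p3:
  fixes A :: "'a set"
  assumes "finite A"
  shows "sub_near_semiring (krom_theories A) (horn_theories A) (\<union>) (\<odot>) {} \<and>
    (\<forall>K \<in> krom_theories A. \<forall>P \<in> horn_theories A. \<forall>R \<in> horn_theories A.
       K \<odot> (P \<union> R) = (K \<odot> P) \<union> (K \<odot> R)) \<and>
    finite (proper_krom_theories A) \<and>
    idempotent_semiring_on (proper_krom_theories A) (\<union>) (\<odot>) {}"
proof (intro conjI ballI)
  show "sub_near_semiring (krom_theories A) (horn_theories A) (\<union>) (\<odot>) {}"
    using near_semiring_on_krom_theories[OF assms]
    by (simp add: sub_near_semiring_def krom_theories_def)
qed (simp_all add: krom_compose_Un_right finite_proper_krom_theories[OF assms]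
    idempotent_semiring_on_proper_krom_theories[OF assms])

end
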